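(* Let $M\in\mathbb{C}^{p\times p}$ be nonsingular, let $\mathcal{A}\in\mathbb{C}^{m\times m\times p}$ have tubal index $k$, and let $\mathcal{B}\in\mathbb{C}^{m\times 1\times p}$. If $\mathcal{B}\in\mathscr{R}_M(\mathcal{A}^k)$, then $\mathcal{A}^{\mathrm D}*_M\mathcal{B}$ is the only solution of $\mathcal{A}*_M\mathcal{X}=\mathcal{B}$ in $\mathscr{R}_M(\mathcal{A}^k)$.
   Context: Transform: for $\mathcal{A}\in\mathbb{C}^{m\times n\times p}$, $\tilde{\mathcal{A}}=\mathcal{A}\times_3 M\in\mathbb{C}^{m\times n\times p}$ is given by $(\tilde{\mathcal{A}})_{ijk}=\sum_{s=1}^p(\mathcal{A})_{ijs}M_{ks}$, and $\tilde{\mathcal{A}}^{(i)}=\tilde{\mathcal{A}}(:,:,i)$ is its $i$th frontal slice. Since $M$ is nonsingular, $\mathcal{A}\mapsto\tilde{\mathcal{A}}$ is a bijection. $M$-product: for $\mathcal{A}\in\mathbb{C}^{m\times n\times p}$, $\mathcal{B}\in\mathbb{C}^{n\times l\times p}$, $\mathcal{A}*_M\mathcal{B}$ is the unique $\mathcal{C}\in\mathbb{C}^{m\times l\times p}$ with $\tilde{\mathcal{C}}^{(i)}=\tilde{\mathcal{A}}^{(i)}\tilde{\mathcal{B}}^{(i)}$, $i=1,\dots,p$. The identity tensor $\mathcal{I}$ has $\tilde{\mathcal{I}}^{(i)}=I_m$ for all $i$; powers are taken with respect to $*_M$, with $\mathcal{A}^0=\mathcal{I}$. Range: $\mathscr{R}_M(\mathcal{A})=\{\mathcal{A}*_M\mathcal{Z}:\mathcal{Z}\in\mathbb{C}^{n\times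 1\times p}\}$ for $\mathcal{A}\in\mathbb{C}^{m\times n\times p}$. Tubal index of $\mathcal{A}\in\mathbb{C}^{m\times m\times p}$: $k=\max_{1\le i\le p}\mathrm{ind}(\tilde{\mathcal{A}}^{(i)})$, where $\mathrm{ind}(A)$ is the least integer $k\ge 0$ with $\mathrm{rank}(A^k)=\mathrm{rank}(A^{k+1})$. Drazin inverse: for $\mathcal{A}$ of tubal index $k$, $\mathcal{A}^{\mathrm D}$ is the unique $\mathcal{X}\in\mathbb{C}^{m\times m\times p}$ with $\mathcal{X}*_M\mathcal{A}*_M\mathcal{X}=\mathcal{X}$, $\mathcal{A}*_M\mathcal{X}=\mathcal{X}*_M\mathcal{A}$ and $\mathcal{X}*_M\mathcal{A}^{k+1}=\mathcal{A}^k$. *)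

theory Defs
  imports "HOL-Analysis.Analysis"
begin

text \<open>
  The entry \<open>(i, j, s)\<close> of a third-order tensor \<open>A\<close> of size \<open>m \<times> n \<times> p\<close> is \<open>A $ i $ j $ s\<close>;
  the sizes are the cardinalities of the index types.
\<close>

type_synonym ('m, 'n, 'p) tensor = "complex ^ 'p ^ 'n ^ 'm"

definition transform ::
  "complex ^ 'p ^ 'p \<Rightarrow> ('m::finite, 'n::finite, 'p::finite) tensor \<Rightarrow> ('m, 'n, 'p) tensor"
  where "transform M A = (\<chi> i j k. \<Sum>s\<in>UNIV. A $ i $ j $ s * M $ k $ s)"

definition slice :: "('m::finite, 'n::finite, 'p::finite) tensor \<Rightarrow> 'p \<Rightarrow> complex ^ 'n ^ 'm"
  where "slice A k = (\<chi> i j. A $ i $ j $ k)"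

definition mprod ::
  "complex ^ 'p ^ 'p \<Rightarrow> ('m::finite, 'n::finite, 'p::finite) tensor
     \<Rightarrow> ('n, 'l::finite, 'p) tensor \<Rightarrow> ('m, 'l, 'p) tensor"
  where "mprod M A B =
    (THE C. \<forall>i. slice (transform M C) i = slice (transform M A) i ** slice (transform M B) i)"

definition mident :: "complex ^ 'p ^ 'p \<Rightarrow> ('m::finite, 'm, 'p::finite) tensor"
  where "mident M = (THE C. \<forall>i. slice (transform M C) i = mat 1)"

primrec mpower ::
  "complex ^ 'p ^ 'p \<Rightarrow> ('m::finite, 'm, 'p::finite) tensor \<Rightarrow> nat \<Rightarrow> ('m, 'm, 'p) tensor"
  where
    "mpower M A 0 = mident M"
  | "mpower M A (Suc n) = mprod M (mpower M A n) A"

definition mrange ::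
  "complex ^ 'p ^ 'p \<Rightarrow> ('m::finite, 'n::finite, 'p::finite) tensor \<Rightarrow> ('m, 1, 'p) tensor set"
  where "mrange M A = {mprod M A Z |Z :: ('n, 1, 'p) tensor. True}"

text \<open>
  The library's \<open>^\<close> on square matrices is the power for the componentwise product,
  so powers for \<open>**\<close> are defined here.
\<close>

primrec matpow :: "complex ^ 'm ^ 'm::finite \<Rightarrow> nat \<Rightarrow> complex ^ 'm ^ 'm"
  where
    "matpow A 0 = mat 1"
  | "matpow A (Suc n) = matpow A n ** A"

definition matrix_index :: "complex ^ 'm ^ 'm::finite \<Rightarrow> nat"
  where "matrix_index A = (LEAST k. rank (matpow A k) = rank (matpow A (Suc k)))"

definition tubal_index ::
  "complex ^ 'p ^ 'p \<Rightarrow> ('m::finite, 'm, 'p::finite) tensor \<Rightarrow> nat"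
  where "tubal_index M A = (MAX i\<in>UNIV. matrix_index (slice (transform M A) i))"

definition drazin ::
  "complex ^ 'p ^ 'p \<Rightarrow> ('m::finite, 'm, 'p::finite) tensor \<Rightarrow> ('m, 'm, 'p) tensor"
  where "drazin M A =
    (THE X. mprod M (mprod M X A) X = X
          \<and> mprod M A X = mprod M X A
          \<and> mprod M X (mpower M A (tubal_index M A + 1)) = mpower M A (tubal_index M A))"

text \<open>For nonsingular \<open>M\<close>, the descriptions of \<open>mprod\<close> and \<open>mident\<close> determine a unique tensor.\<close>

lemma ex1_slices:
  fixes M :: "complex ^ 'p ^ 'p" and F :: "'p::finite \<Rightarrow> complex ^ 'n::finite ^ 'm::finite"
  assumes "invertible M"
  shows "\<exists>!C. \<forall>i. slice (transform M C) i = F i"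
proof -
  have slice_iff: "(\<forall>k. slice (transform M C) k = F k) \<longleftrightarrow>
      (\<forall>i j. M *v (C $ i $ j) = (\<chi> k. F k $ i $ j))" for C
    by (auto simp: slice_def transform_def vec_eq_iff matrix_vector_mult_def mult.commute)
  obtain N where N: "M ** N = mat 1" "N ** M = mat 1"
    using assms unfolding invertible_def by blast
  have solve: "M *v x = y \<longleftrightarrow> x = N *v y" for x y
    by (metis N matrix_vector_mul_assoc matrix_vector_mul_lid)
  show ?thesis
    unfolding slice_iff solve
    by (rule ex1I[of _ "\<chi> i j. N *v (\<chi> k. F k $ i $ j)"]) (simp_all add: vec_eq_iff)
qed

lemma slice_mprod:
  assumes "invertible M"
  shows "slice (transform M (mprod M A B)) i = slice (transform M A) i ** slice (transform M B) i"
  using theI'[OF ex1_slices[OF assms, of "\<lambda>i. slice (transform M A) i ** slice (transform M B) i"]]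
  unfolding mprod_def by blast

lemma slice_mident:
  assumes "invertible M"
  shows "slice (transform M (mident M)) i = mat 1"
  using theI'[OF ex1_slices[OF assms, of "\<lambda>i. mat 1"]]
  unfolding mident_def by blast

end

theory Submission
  imports Defs
begin

text \<open>
  Write \<open>D\<close> for the Drazin inverse and \<open>P = A\<^sup>k\<close>. Once the defining equations of \<open>D\<close> are available,
  the theorem is a short computation: from \<open>D A\<^sup>k\<^sup>+\<^sup>1 = A\<^sup>k\<close> it follows that \<open>D\<close> undoes \<open>A\<close> on the
  range of \<open>P\<close>, that is \<open>D (A (P W)) = P W\<close>. As \<open>D\<close> commutes with \<open>A\<close>, it maps the range of \<open>P\<close>
  into itself and satisfies \<open>A (D B) = D (A B) = B\<close> there. Any solution \<open>X\<close> in the range is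
  \<open>D (A X) = D B\<close>.

  The substance of the proof is that these equations hold at all, since \<open>D\<close> is given by a definite
  description: there has to be exactly one tensor satisfying them. The transform turns the
  \<open>M\<close>-product into independent matrix products of the slices, so it suffices to treat one matrix
  \<open>A\<close> whose index is at most \<open>k\<close>.

  For matrices the argument splits into a part about ranks and a part that makes sense in every
  monoid. Equality of the ranks of \<open>A\<^sup>j\<close> and \<open>A\<^sup>j\<^sup>+\<^sup>1\<close> gives factorisations
  \<open>A\<^sup>j = A\<^sup>j\<^sup>+\<^sup>1 Y\<close> and \<open>A\<^sup>j = W A\<^sup>j\<^sup>+\<^sup>1\<close> (\<open>left_factor_of_rank_eq\<close>,
  \<open>right_factor_of_left_factor\<close>). In a monoid two such factorisations produce the Drazin inverse
  \<open>A\<^sup>k Y\<^sup>k\<^sup>+\<^sup>1 = W\<^sup>k\<^sup>+\<^sup>1 A\<^sup>k\<close> (\<open>drazin_inverse_exists\<close>), and its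
  defining equations determine it (\<open>drazin_inverse_unique\<close>).
\<close>

section \<open>Drazin inverses in a monoid\<close>

context monoid
begin

primrec pow :: "'a \<Rightarrow> nat \<Rightarrow> 'a"
  where
    "pow a 0 = \<^bold>1"
  | "pow a (Suc n) = pow a n \<^bold>* a"

definition is_drazin_inverse :: "'a \<Rightarrow> nat \<Rightarrow> 'a \<Rightarrow> bool"
  where "is_drazin_inverse a k x \<longleftrightarrow>
    x \<^bold>* a \<^bold>* x = x \<and> a \<^bold>* x = x \<^bold>* a \<and> x \<^bold>* pow a (k + 1) = pow a k"

lemma pow_commutes: "a \<^bold>* b = b \<^bold>* a \<Longrightarrow> pow a n \<^bold>* b = b \<^bold>* pow a n"
  by (induction n) (simp_all add: assoc, metis assoc)

lemma pow_Suc_left: "pow a (Suc n) = a \<^bold>* pow a n"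
  by (simp add: pow_commutes)

lemma pow_add: "pow a (m + n) = pow a m \<^bold>* pow a n"
  by (induction n) (simp_all add: assoc)

text \<open>
  A factorisation at exponent \<open>j\<close> passes to all larger exponents by multiplication with a power of \<open>a\<close>
  from the left (here) or from the right (in the next lemma). This is what allows
  one common exponent for all slices of a tensor, whose own indices may be smaller.
\<close>

lemma pow_eq_right_mono:
  assumes "pow a j = pow a (Suc j) \<^bold>* y" and "j \<le> k"
  shows "pow a k = pow a (Suc k) \<^bold>* y"
proof -
  have "pow a k = pow a (k - j) \<^bold>* pow a j"
    using \<open>j \<le> k\<close> by (simp flip: pow_add)
  also have "\<dots> = pow a (k - j) \<^bold>* pow a (Suc j) \<^bold>* y"
    by (subst assms(1)) (simp only: assoc)
  also have "\<dots> = pow a (Suc k) \<^bold>* y"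
    using \<open>j \<le> k\<close> by (simp only: pow_add[symmetric]) (simp add: Suc_diff_le)
  finally show ?thesis .
qed

lemma pow_eq_left_mono:
  assumes "pow a j = w \<^bold>* pow a (Suc j)" and "j \<le> k"
  shows "pow a k = w \<^bold>* pow a (Suc k)"
proof -
  have "pow a k = pow a j \<^bold>* pow a (k - j)"
    using \<open>j \<le> k\<close> by (simp flip: pow_add)
  also have "\<dots> = w \<^bold>* (pow a (Suc j) \<^bold>* pow a (k - j))"
    by (subst assms(1)) (simp only: assoc)
  also have "\<dots> = w \<^bold>* pow a (Suc k)"
    using \<open>j \<le> k\<close> by (simp only: pow_add[symmetric]) simp
  finally show ?thesis .
qed

lemma pow_eq_right_iterate:
  assumes "pow a k = pow a (Suc k) \<^bold>* y"
  shows "pow a (k + n) \<^bold>* pow y n = pow a k"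
proof (induction n)
  case (Suc n)
  have shift: "pow a (Suc (k + n)) \<^bold>* y = pow a (k + n)"
    by (rule pow_eq_right_mono[OF assms, symmetric]) simp
  have "pow a (k + Suc n) \<^bold>* pow y (Suc n) = pow a (Suc (k + n)) \<^bold>* y \<^bold>* pow y n"
    by (simp only: pow_Suc_left[of y] add_Suc_right assoc)
  then show ?case
    by (simp only: shift Suc.IH)
qed simp

lemma pow_eq_left_iterate:
  assumes "pow a k = w \<^bold>* pow a (Suc k)"
  shows "pow w n \<^bold>* pow a (k + n) = pow a k"
proof (induction n)
  case (Suc n)
  have shift: "w \<^bold>* pow a (Suc (k + n)) = pow a (k + n)"
    by (rule pow_eq_left_mono[OF assms, symmetric]) simp
  have "pow w (Suc n) \<^bold>* pow a (k + Suc n) = pow w n \<^bold>* (w \<^bold>* pow a (Suc (k + n)))"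
    by (simp only: pow.simps(2)[of w] add_Suc_right assoc)
  then show ?case
    by (simp only: shift Suc.IH)
qed simp

text \<open>
  The witness has two descriptions, one by \<open>y\<close> and one by \<open>w\<close>, which agree because both equal
  \<open>w\<^sup>n a\<^sup>k\<^sup>+\<^sup>n y\<^sup>n\<close> with \<open>n = k + 1\<close>. The first is suited to multiplication by \<open>a\<close> from the left, the
  second to multiplication from the right; comparing the results shows that the witness commutes
  with \<open>a\<close>.
\<close>

lemma drazin_inverse_exists:
  assumes right: "pow a k = pow a (Suc k) \<^bold>* y" and left: "pow a k = w \<^bold>* pow a (Suc k)"
  shows "\<exists>x. is_drazin_inverse a k x"
proof -
  have mixed: "pow w n \<^bold>* pow a k = pow a k \<^bold>* pow y n" for n
  proof -
    have "pow w n \<^bold>* pow a k = pow w n \<^bold>* (pow a (k + n) \<^bold>* pow y n)"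
      by (simp only: pow_eq_right_iterate[OF right])
    also have "\<dots> = pow w n \<^bold>* pow a (k + n) \<^bold>* pow y n"
      by (simp only: assoc)
    also have "\<dots> = pow a k \<^bold>* pow y n"
      by (simp only: pow_eq_left_iterate[OF left])
    finally show ?thesis .
  qed
  have cancel_right: "a \<^bold>* (pow a k \<^bold>* pow y (Suc n)) = pow a k \<^bold>* pow y n" for n
  proof -
    have "a \<^bold>* (pow a k \<^bold>* pow y (Suc n)) = pow a (Suc k) \<^bold>* y \<^bold>* pow y n"
      by (simp only: pow_Suc_left assoc)
    then show ?thesis
      by (simp only: right[symmetric])
  qed
  have cancel_left: "pow w (Suc n) \<^bold>* pow a k \<^bold>* a = pow w n \<^bold>* pow a k" for n
  proof -
    have "pow w (Suc n) \<^bold>* pow a k \<^bold>* a = pow w n \<^bold>* (w \<^bold>* pow a (Suc k))"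
      by (simp only: pow.simps(2) assoc)
    then show ?thesis
      by (simp only: left[symmetric])
  qed
  define x where "x = pow a k \<^bold>* pow y (Suc k)"
  have x: "x = pow w (Suc k) \<^bold>* pow a k"
    by (simp only: x_def mixed)
  have ax: "a \<^bold>* x = pow a k \<^bold>* pow y k"
    by (simp only: x_def cancel_right)
  have xa: "x \<^bold>* a = pow w k \<^bold>* pow a k"
    by (simp only: x cancel_left)
  have commute: "a \<^bold>* x = x \<^bold>* a"
    by (simp only: ax xa mixed)
  have "x \<^bold>* pow a (k + 1) = pow w (Suc k) \<^bold>* pow a (k + Suc k)"
    by (simp only: x pow_add assoc Suc_eq_plus1)
  then have fixes_pow: "x \<^bold>* pow a (k + 1) = pow a k"
    by (simp only: pow_eq_left_iterate[OF left])
  have "x \<^bold>* a \<^bold>* x = (x \<^bold>* pow a (k + 1)) \<^bold>* pow y (Suc k)"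
    by (simp only: x_def assoc Suc_eq_plus1[symmetric] pow_Suc_left[of a])
  also have "\<dots> = x"
    by (simp only: fixes_pow) (simp only: x_def)
  finally show ?thesis
    using commute fixes_pow unfolding is_drazin_inverse_def by blast
qed

text \<open>
  A Drazin inverse \<open>x\<close> satisfies \<open>a x\<^sup>2 = x\<close>, so it is a multiple of every power of \<open>a\<close>. Hence identities
  that only hold for the power \<open>a\<^sup>k\<close> can be applied to \<open>x\<close> itself.
\<close>

lemma pow_mult_pow_drazin_inverse:
  assumes "is_drazin_inverse a k x"
  shows "pow a n \<^bold>* pow x (Suc n) = x"
proof (induction n)
  case (Suc n)
  have "a \<^bold>* x \<^bold>* x = x"
    using assms unfolding is_drazin_inverse_def by simp
  then have absorb: "a \<^bold>* (x \<^bold>* (x \<^bold>* pow x n)) = x \<^bold>* pow x n"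
    by (simp only: assoc[symmetric])
  have "pow a (Suc n) \<^bold>* pow x (Suc (Suc n)) = pow a n \<^bold>* (a \<^bold>* (x \<^bold>* (x \<^bold>* pow x n)))"
    by (simp only: pow_Suc_left[of x] pow.simps(2)[of a] assoc)
  also have "\<dots> = pow a n \<^bold>* pow x (Suc n)"
    by (simp only: absorb pow_Suc_left[of x])
  finally show ?case
    by (simp only: Suc.IH)
qed simp

text \<open>
  Both inverses equal \<open>x a y\<close>: writing \<open>x = x\<^sup>k\<^sup>+\<^sup>1 a\<^sup>k\<close> and replacing \<open>a\<^sup>k\<close> by \<open>a\<^sup>k\<^sup>+\<^sup>1 y\<close> turns \<open>x\<close> into \<open>x a y\<close>;
  writing \<open>y = a\<^sup>k y\<^sup>k\<^sup>+\<^sup>1\<close>, the factor \<open>x\<close> in \<open>x a y\<close> is absorbed by \<open>x a\<^sup>k\<^sup>+\<^sup>1 = a\<^sup>k\<close>.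
\<close>

lemma drazin_inverse_unique:
  assumes x: "is_drazin_inverse a k x" and y: "is_drazin_inverse a k y"
  shows "x = y"
proof -
  have x_commute: "a \<^bold>* x = x \<^bold>* a" and y_commute: "a \<^bold>* y = y \<^bold>* a"
    and x_pow: "x \<^bold>* pow a (Suc k) = pow a k" and y_pow: "y \<^bold>* pow a (Suc k) = pow a k"
    using x y unfolding is_drazin_inverse_def by simp_all
  have "pow x (Suc k) \<^bold>* pow a k = pow a k \<^bold>* pow x (Suc k)"
    by (intro pow_commutes pow_commutes[symmetric] x_commute)
  then have x_eq: "x = pow x (Suc k) \<^bold>* pow a k"
    by (simp only: pow_mult_pow_drazin_inverse[OF x])
  have y_right: "pow a (Suc k) \<^bold>* y = pow a k"
    by (simp only: pow_commutes[OF y_commute] y_pow)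
  have "x = pow x (Suc k) \<^bold>* (pow a (Suc k) \<^bold>* y)"
    unfolding y_right by (rule x_eq)
  also have "\<dots> = pow x (Suc k) \<^bold>* pow a k \<^bold>* a \<^bold>* y"
    by (simp only: assoc pow.simps(2))
  also have "\<dots> = x \<^bold>* a \<^bold>* y"
    by (simp only: x_eq[symmetric])
  also have "\<dots> = x \<^bold>* a \<^bold>* (pow a k \<^bold>* pow y (Suc k))"
    by (simp only: pow_mult_pow_drazin_inverse[OF y])
  also have "\<dots> = x \<^bold>* pow a (Suc k) \<^bold>* pow y (Suc k)"
    by (simp only: assoc pow_Suc_left[of a])
  also have "\<dots> = pow a k \<^bold>* pow y (Suc k)"
    by (simp only: x_pow)
  also have "\<dots> = y"
    by (rule pow_mult_pow_drazin_inverse[OF y])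
  finally show ?thesis .
qed

end

section \<open>Matrices over a field\<close>

lemma matrix_vector_mult_axis:
  fixes A :: "'a::field ^ 'n ^ 'm"
  shows "A *v axis j 1 = column j A"
  by (simp add: vec_eq_iff matrix_vector_mult_def column_def axis_def if_distrib cong: if_cong)

lemma span_columns_eq_range:
  fixes A :: "'a::field ^ 'n ^ 'm"
  shows "vec.span (columns A) = range ((*v) A)"
proof
  have "column i A = A *v axis i 1" for i
    by (simp add: matrix_vector_mult_axis)
  then have "columns A \<subseteq> range ((*v) A)"
    by (auto simp: columns_def)
  moreover have "vec.subspace (range ((*v) A))"
    by (intro vec.subspace_image vec.subspace_UNIV)
  ultimately show "vec.span (columns A) \<subseteq> range ((*v) A)"
    by (rule vec.span_minimal)
qed (auto simp: matrix_vector_mult_in_columnspace_gen)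

text \<open>
  The rank of a matrix over an arbitrary field is defined as its row rank, so it is the range of the
  transpose whose dimension is known from it.
\<close>

lemma rank_eq_dim_range_transpose:
  fixes A :: "'a::field ^ 'n ^ 'm"
  shows "rank A = vec.dim (range ((*v) (transpose A)))"
  unfolding row_rank_def_gen span_columns_eq_range[symmetric] columns_transpose vec.dim_span ..

lemma range_matrix_mult_subset:
  fixes A :: "'a::field ^ 'n ^ 'm"
  shows "range ((*v) (A ** B)) \<subseteq> range ((*v) A)"
  by (auto simp flip: matrix_vector_mul_assoc)

lemma matrix_factor_of_range_subset:
  fixes A :: "'a::field ^ 'n ^ 'm" and B :: "'a ^ 'l ^ 'm"
  assumes "range ((*v) B) \<subseteq> range ((*v) A)"
  shows "\<exists>Y. B = A ** Y"
proof -
  have "\<forall>j. \<exists>y. B *v axis j 1 = A *v y"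
    using assms by auto
  then obtain y where y: "\<And>j. B *v axis j 1 = A *v y j"
    by metis
  have "B $ i $ j = (A ** (\<chi> i j. y j $ i)) $ i $ j" for i j
    using arg_cong[OF y[of j], of "\<lambda>v. v $ i"]
    unfolding matrix_vector_mult_axis
    by (simp add: column_def matrix_matrix_mult_def matrix_vector_mult_def)
  then show ?thesis
    by (metis vec_eq_iff)
qed

lemma rank_mult_le_right_field:
  fixes A :: "'a::field ^ 'n ^ 'm"
  shows "rank (A ** B) \<le> rank B"
  unfolding rank_eq_dim_range_transpose matrix_transpose_mul
  by (intro vec.dim_subset range_matrix_mult_subset)

text \<open>
  The rows of \<open>A ** P\<close> are combinations of the rows of \<open>P\<close>. If the ranks agree, the two row spaces
  coincide, so that conversely the rows of \<open>P\<close> are combinations of the rows of \<open>A ** P\<close>.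
\<close>

lemma left_factor_of_rank_eq:
  fixes A :: "'a::field ^ 'n ^ 'm"
  assumes "rank (A ** P) = rank P"
  shows "\<exists>Z. P = Z ** (A ** P)"
proof -
  have "range ((*v) (transpose (A ** P))) = range ((*v) (transpose P))"
  proof (rule vec.subspace_dim_equal)
    show "range ((*v) (transpose (A ** P))) \<subseteq> range ((*v) (transpose P))"
      unfolding matrix_transpose_mul by (rule range_matrix_mult_subset)
    show "vec.dim (range ((*v) (transpose P))) \<le> vec.dim (range ((*v) (transpose (A ** P))))"
      using assms unfolding rank_eq_dim_range_transpose by simp
  qed (intro vec.subspace_image vec.subspace_UNIV)+
  then obtain Y where "transpose P = transpose (A ** P) ** Y"
    using matrix_factor_of_range_subset by blast
  then have "P = transpose Y ** (A ** P)"
    by (metis matrix_transpose_mul transpose_transpose)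
  then show ?thesis ..
qed

text \<open>
  The factorisation says that \<open>Z\<close> undoes \<open>A\<close> on the range of \<open>P\<close>, so \<open>A\<close> is injective there. Since \<open>A\<close>
  commutes with \<open>P\<close>, it maps this range into itself, and an injective linear map from a
  finite-dimensional space to itself is onto. Thus \<open>P\<close> and \<open>P ** A\<close> have the same range.
\<close>

lemma right_factor_of_left_factor:
  fixes A :: "'a::field ^ 'n ^ 'n"
  assumes left: "P = Z ** (A ** P)" and commute: "A ** P = P ** A"
  shows "\<exists>Y. P = (P ** A) ** Y"
proof -
  let ?R = "range ((*v) P)"
  have image: "(*v) A ` ?R = range ((*v) (P ** A))"
    by (simp add: image_image matrix_vector_mul_assoc commute)
  have "inj_on ((*v) A) ?R"
  proof (rule inj_on_inverseI)
    show "Z *v (A *v v) = v" if "v \<in> ?R" for v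
      using that left by (metis (no_types, lifting) imageE matrix_vector_mul_assoc)
  qed
  moreover have "vec.span ?R = ?R"
    by (metis span_columns_eq_range vec.span_span)
  ultimately have "vec.dim ((*v) A ` ?R) = vec.dim ?R"
    by (intro vec.dim_image_eq) (simp_all only: matrix_vector_mul_linear_gen)
  then have "range ((*v) (P ** A)) = ?R"
    unfolding image
    by (intro vec.subspace_dim_equal range_matrix_mult_subset vec.subspace_image vec.subspace_UNIV) simp
  then show ?thesis
    using matrix_factor_of_range_subset by blast
qed

section \<open>The index of a complex matrix\<close>

interpretation matmul: monoid "(**)" "mat 1 :: complex ^ 'n ^ 'n"
  rewrites "monoid.pow (**) (mat 1 :: complex ^ 'n ^ 'n) = matpow"
proof -
  show mon: "monoid (**) (mat 1 :: complex ^ 'n ^ 'n)"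
    by standard (simp_all add: matrix_mul_assoc)
  have "monoid.pow (**) (mat 1) X n = matpow X n" for X :: "complex ^ 'n ^ 'n" and n
    by (induction n) (simp_all add: monoid.pow.simps[OF mon])
  then show "monoid.pow (**) (mat 1 :: complex ^ 'n ^ 'n) = matpow"
    by blast
qed

text \<open>
  The ranks of the powers decrease, and a sequence of natural numbers cannot decrease strictly
  forever; so the least exponent in the definition of the index exists.
\<close>

lemma rank_matpow_matrix_index:
  "rank (matpow A (matrix_index A)) = rank (matpow A (Suc (matrix_index A)))"
proof -
  have "\<exists>k. rank (matpow A k) = rank (matpow A (Suc k))"
  proof (rule ccontr)
    assume "\<not> ?thesis"
    then have strict: "rank (matpow A (Suc k)) < rank (matpow A k)" for k
      by (metis matmul.pow_Suc_left rank_mult_le_right_field nat_less_le)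
    have "rank (matpow A k) + k \<le> rank (matpow A 0)" for k
    proof (induction k)
      case (Suc k)
      then show ?case using strict[of k] by linarith
    qed simp
    from this[of "Suc (rank (matpow A 0))"] show False by linarith
  qed
  then show ?thesis
    unfolding matrix_index_def by (rule LeastI_ex)
qed

lemma matrix_drazin_inverse_exists:
  assumes "matrix_index A \<le> k"
  shows "\<exists>X. matmul.is_drazin_inverse A k X"
proof -
  let ?j = "matrix_index A"
  let ?P = "matpow A ?j"
  have "rank (A ** ?P) = rank ?P"
    using rank_matpow_matrix_index[of A] by (simp only: matmul.pow_Suc_left)
  then obtain Z where left: "?P = Z ** (A ** ?P)"
    using left_factor_of_rank_eq by blast
  have commute: "A ** ?P = ?P ** A"
    by (metis matmul.pow.simps(2) matmul.pow_Suc_left)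
  obtain Y where right: "?P = (?P ** A) ** Y"
    using right_factor_of_left_factor[OF left commute] by blast
  have "matpow A k = matpow A (Suc k) ** Y"
    by (rule matmul.pow_eq_right_mono[OF _ assms]) (simp only: matpow.simps right[symmetric])
  moreover have "matpow A k = Z ** matpow A (Suc k)"
    by (rule matmul.pow_eq_left_mono[OF _ assms]) (simp only: matmul.pow_Suc_left left[symmetric])
  ultimately show ?thesis
    by (rule matmul.drazin_inverse_exists)
qed

section \<open>From slices to tensors\<close>

lemma tensor_eq_iff_slices:
  assumes "invertible M"
  shows "A = B \<longleftrightarrow> (\<forall>i. slice (transform M A) i = slice (transform M B) i)"
  using ex1_slices[OF assms, of "\<lambda>i. slice (transform M B) i"] by blast

lemma mprod_assoc:
  assumes "invertible M"
  shows "mprod M (mprod M A B) C = mprod M A (mprod M B C)"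
  by (simp add: tensor_eq_iff_slices[OF assms] slice_mprod[OF assms] matrix_mul_assoc)

lemma slice_mpower:
  assumes "invertible M"
  shows "slice (transform M (mpower M A n)) i = matpow (slice (transform M A) i) n"
  by (induction n) (simp_all add: slice_mprod[OF assms] slice_mident[OF assms])

text \<open>
  The equations that describe the Drazin inverse of a tensor hold exactly if every slice satisfies
  the corresponding matrix equations, so existence and uniqueness are inherited from the slices.
\<close>

lemma drazin_equations:
  fixes A :: "('m::finite, 'm, 'p::finite) tensor"
  assumes "invertible M"
  defines "k \<equiv> tubal_index M A"
  shows "mprod M A (drazin M A) = mprod M (drazin M A) A"
    and "mprod M (drazin M A) (mpower M A (Suc k)) = mpower M A k"
proof -
  let ?A = "slice (transform M A)"
  let ?P = "\<lambda>X. mprod M (mprod M X A) X = X \<and> mprod M A X = mprod M X A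
    \<and> mprod M X (mpower M A (k + 1)) = mpower M A k"
  have slicewise: "?P X \<longleftrightarrow> (\<forall>i. matmul.is_drazin_inverse (?A i) k (slice (transform M X) i))" for X
    unfolding tensor_eq_iff_slices[OF assms(1)] matmul.is_drazin_inverse_def
      slice_mprod[OF assms(1)] slice_mpower[OF assms(1)]
    by blast
  have "matrix_index (?A i) \<le> k" for i
    unfolding k_def tubal_index_def by simp
  then have "\<forall>i. \<exists>X. matmul.is_drazin_inverse (?A i) k X"
    using matrix_drazin_inverse_exists by blast
  then obtain F where F: "\<And>i. matmul.is_drazin_inverse (?A i) k (F i)"
    by metis
  obtain X where "\<forall>i. slice (transform M X) i = F i"
    using ex1_slices[OF assms(1)] by blast
  with F have X: "?P X"
    unfolding slicewise by simp
  have unique: "Y = X" if "?P Y" for Y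
    using that X matmul.drazin_inverse_unique
    unfolding slicewise tensor_eq_iff_slices[OF assms(1), of Y] by blast
  have "?P (drazin M A)"
    unfolding drazin_def k_def[symmetric] by (rule theI[of ?P, OF X unique])
  then show "mprod M A (drazin M A) = mprod M (drazin M A) A"
    and "mprod M (drazin M A) (mpower M A (Suc k)) = mpower M A k"
    unfolding Suc_eq_plus1 by blast+
qed

lemma mprod_commute_mpower:
  assumes "invertible M" and "mprod M A X = mprod M X A"
  shows "mprod M X (mpower M A n) = mprod M (mpower M A n) X"
proof -
  have "slice (transform M A) i ** slice (transform M X) i
      = slice (transform M X) i ** slice (transform M A) i" for i
    using assms(2) by (metis slice_mprod[OF assms(1)])
  then show ?thesis
    by (simp add: tensor_eq_iff_slices[OF assms(1)] slice_mprod[OF assms(1)]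
        slice_mpower[OF assms(1)] matmul.pow_commutes)
qed

theorem theorem6p2:
  fixes M :: "complex ^ 'p ^ 'p"
    and A :: "('m::finite, 'm, 'p::finite) tensor"
    and B :: "('m, 1, 'p) tensor"
    and k :: nat
  assumes "invertible M"
    and "tubal_index M A = k"
    and "B \<in> mrange M (mpower M A k)"
  shows "mprod M (drazin M A) B \<in> mrange M (mpower M A k)
    \<and> mprod M A (mprod M (drazin M A) B) = B
    \<and> (\<forall>X \<in> mrange M (mpower M A k). mprod M A X = B \<longrightarrow> X = mprod M (drazin M A) B)"
proof -
  note inv = \<open>invertible M\<close>
  note assoc = mprod_assoc[OF inv]
  let ?D = "drazin M A" and ?P = "mpower M A k"
  have commute: "mprod M A ?D = mprod M ?D A"
    and fixes_power: "mprod M ?D (mpower M A (Suc k)) = ?P"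
    using drazin_equations[OF inv, of A] unfolding assms(2) by blast+
  have power_commute: "mprod M ?P A = mprod M A ?P"
    by (rule mprod_commute_mpower[OF inv refl, symmetric])
  have left_inverse: "mprod M ?D (mprod M A X) = X" if "X \<in> mrange M ?P" for X
  proof -
    obtain W :: "('m, 1, 'p) tensor" where "X = mprod M ?P W"
      using \<open>X \<in> mrange M ?P\<close> unfolding mrange_def by blast
    moreover have "mprod M ?D (mprod M A (mprod M ?P W))
        = mprod M (mprod M ?D (mpower M A (Suc k))) W"
      by (simp only: mpower.simps power_commute assoc)
    ultimately show ?thesis
      by (simp only: fixes_power)
  qed
  obtain Z :: "('m, 1, 'p) tensor" where B: "B = mprod M ?P Z"
    using assms(3) unfolding mrange_def by blast
  have "mprod M ?D B = mprod M ?P (mprod M ?D Z)"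
    unfolding B by (simp only: assoc[symmetric] mprod_commute_mpower[OF inv commute])
  then have "mprod M ?D B \<in> mrange M ?P"
    unfolding mrange_def by blast
  moreover have "mprod M A (mprod M ?D B) = B"
    by (simp only: assoc[symmetric] commute) (simp only: assoc left_inverse[OF assms(3)])
  moreover have "X = mprod M ?D B" if "X \<in> mrange M ?P" and "mprod M A X = B" for X
    using left_inverse[OF that(1)] unfolding that(2) by (rule sym)
  ultimately show ?thesis
    by blast
qed

end
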